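(* Let $k>0$ be a real number and let $n,m\ge 0$ be integers. Then $$\mathbb{H}F_{k,n+1}\,\mathbb{H}F_{k,m}+\mathbb{H}F_{k,n}\,\mathbb{H}F_{k,m-1}=2\,\mathbb{H}F_{k,n+m}+k\,F_{k,n+m+1}+L_{k,n+m+5},$$ where $k$ in the term $k\,F_{k,n+m+1}$ is the real parameter.
   Context: For a real number $k>0$, the $k$-Fibonacci numbers are defined by $F_{k,0}=0$, $F_{k,1}=1$, $F_{k,n+1}=kF_{k,n}+F_{k,n-1}$, extended to negative indices by the same recurrence (so $F_{k,-1}=1$). The $k$-Lucas numbers are defined by $L_{k,0}=2$, $L_{k,1}=k$, $L_{k,n+1}=kL_{k,n}+L_{k,n-1}$; equivalently $L_{k,n}=F_{k,n+1}+F_{k,n-1}$. The hyperbolic quaternions form the real four-dimensional algebra with basis $1,\mathbf{i},\mathbf{j},\mathbf{k}$, unit $1$, and bilinear (non-commutative) product determined by $\mathbf{i}^2=\mathbf{j}^2=\mathbf{k}^2=1$, $\mathbf{i}\mathbf{j}=\mathbf{k}=-\mathbf{j}\mathbf{i}$, $\mathbf{j}\mathbf{k}=\mathbf{i}=-\mathbf{k}\mathbf{j}$, $\mathbf{k}\mathbf{i}=\mathbf{j}=-\mathbf{i}\mathbf{k}$. The unit $\mathbf{k}$ is distinct from the real parameter $k$. Real numbers are identified with real multiples of $1$. The $n$-th hyperbolic $k$-Fibonacci quaternion is $\mathbb{H}F_{k,n}=F_{k,n}+\mathbf{i}F_{k,n+1}+\mathbf{j}F_{k,n+2}+\mathbf{k}F_{k,n+3}$.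 *)

theory Defs
  imports Complex_Main
begin

section \<open>\<open>k\<close>-Fibonacci and \<open>k\<close>-Lucas numbers\<close>

text \<open>
  The index ranges over all integers. Below \<open>0\<close> the recurrence
  \<open>F (n + 1) = k * F n + F (n - 1)\<close> is solved for the term with the smallest index;
  \<open>kfib_rec\<close> states the recurrence in its original form on all of the integers.
\<close>

function kfib :: "real \<Rightarrow> int \<Rightarrow> real" where
  "kfib k n =
     (if n = 0 then 0
      else if n = 1 then 1
      else if n > 1 then k * kfib k (n - 1) + kfib k (n - 2)
      else kfib k (n + 2) - k * kfib k (n + 1))"
  by pat_completeness auto
termination
  by (relation "measure (\<lambda>(k, n). nat (if n \<ge> 0 then n else 2 - n))") auto

declare kfib.simps [simp del]

lemma kfib_0 [simp]: "kfib k 0 = 0"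
  by (simp add: kfib.simps)

lemma kfib_1 [simp]: "kfib k 1 = 1"
  by (simp add: kfib.simps)

lemma kfib_rec: "kfib k (n + 1) = k * kfib k n + kfib k (n - 1)"
proof (cases "n > 0")
  case True
  then show ?thesis by (subst kfib.simps) simp
next
  case False
  then have "kfib k (n - 1) = kfib k (n - 1 + 2) - k * kfib k (n - 1 + 1)"
    by (subst kfib.simps) simp
  then show ?thesis by (simp add: algebra_simps)
qed

lemma kfib_minus_1 [simp]: "kfib k (- 1) = 1"
  using kfib_rec [of k 0] by simp

fun kluc :: "real \<Rightarrow> nat \<Rightarrow> real" where
  "kluc k 0 = 2"
| "kluc k (Suc 0) = k"
| "kluc k (Suc (Suc n)) = k * kluc k (Suc n) + kluc k n"

lemma kluc_eq_kfib: "kluc k n = kfib k (int n + 1) + kfib k (int n - 1)"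
proof (induction k n rule: kluc.induct)
  case (1 k)
  then show ?case by simp
next
  case (2 k)
  then show ?case using kfib_rec [of k 1] by simp
next
  case (3 k n)
  have "kfib k (int n + 3) = k * kfib k (int n + 2) + kfib k (int n + 1)"
    using kfib_rec [of k "int n + 2"] by (simp add: algebra_simps)
  moreover have "kfib k (int n + 1) = k * kfib k (int n) + kfib k (int n - 1)"
    by (rule kfib_rec)
  ultimately show ?case using 3 by (simp add: algebra_simps)
qed


section \<open>Hyperbolic quaternions\<close>

text \<open>
  The product is not associative, e.g. \<open>(i j) j = - i\<close> but \<open>i (j j) = i\<close>. Hence the type has no
  instance of \<open>real_algebra_1\<close>, and \<open>of_real\<close> is not available for the embedding of the reals.
\<close>

datatype hquat = HQuat (hq_re: real) (hq_i: real) (hq_j: real) (hq_k: real)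

lemma hquat_eq_iff:
  "x = y \<longleftrightarrow> hq_re x = hq_re y \<and> hq_i x = hq_i y \<and> hq_j x = hq_j y \<and> hq_k x = hq_k y"
  by (cases x; cases y) simp

instantiation hquat :: real_vector
begin

definition "0 = HQuat 0 0 0 0"

definition "x + y = HQuat (hq_re x + hq_re y) (hq_i x + hq_i y) (hq_j x + hq_j y) (hq_k x + hq_k y)"

definition "- x = HQuat (- hq_re x) (- hq_i x) (- hq_j x) (- hq_k x)"

definition "x - y = HQuat (hq_re x - hq_re y) (hq_i x - hq_i y) (hq_j x - hq_j y) (hq_k x - hq_k y)"

definition "r *\<^sub>R x = HQuat (r * hq_re x) (r * hq_i x) (r * hq_j x) (r * hq_k x)"

instance
  by standard
    (simp_all add: hquat_eq_iff zero_hquat_def plus_hquat_def uminus_hquat_def minus_hquat_def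
      scaleR_hquat_def algebra_simps)

end

definition hq_I :: hquat where "hq_I = HQuat 0 1 0 0"
definition hq_J :: hquat where "hq_J = HQuat 0 0 1 0"
definition hq_K :: hquat where "hq_K = HQuat 0 0 0 1"

instantiation hquat :: "{one, times}"
begin

definition "1 = HQuat 1 0 0 0"

text \<open>
  The bilinear extension of the multiplication table; see \<open>hq_table\<close> and \<open>bilinear_hq_times\<close>.
\<close>

definition "x * y = HQuat
  (hq_re x * hq_re y + hq_i x * hq_i y + hq_j x * hq_j y + hq_k x * hq_k y)
  (hq_re x * hq_i y + hq_i x * hq_re y + hq_j x * hq_k y - hq_k x * hq_j y)
  (hq_re x * hq_j y + hq_j x * hq_re y + hq_k x * hq_i y - hq_i x * hq_k y)
  (hq_re x * hq_k y + hq_k x * hq_re y + hq_i x * hq_j y - hq_j x * hq_i y)"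

instance ..

end

definition hq_of_real :: "real \<Rightarrow> hquat" where
  "hq_of_real r = r *\<^sub>R 1"

lemmas hq_defs = zero_hquat_def plus_hquat_def uminus_hquat_def minus_hquat_def scaleR_hquat_def
  one_hquat_def times_hquat_def hq_I_def hq_J_def hq_K_def hq_of_real_def

lemma hq_basis:
  "x = hq_re x *\<^sub>R 1 + hq_i x *\<^sub>R hq_I + hq_j x *\<^sub>R hq_J + hq_k x *\<^sub>R hq_K"
  by (simp add: hquat_eq_iff hq_defs)

lemma hq_one: "1 * x = x" "x * 1 = x" for x :: hquat
  by (simp_all add: hquat_eq_iff hq_defs)

lemma hq_table:
  "hq_I * hq_I = 1" "hq_J * hq_J = 1" "hq_K * hq_K = 1"
  "hq_I * hq_J = hq_K" "hq_J * hq_I = - hq_K"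
  "hq_J * hq_K = hq_I" "hq_K * hq_J = - hq_I"
  "hq_K * hq_I = hq_J" "hq_I * hq_K = - hq_J"
  by (simp_all add: hquat_eq_iff hq_defs)

lemma bilinear_hq_times:
  fixes x y z :: hquat
  shows "(x + y) * z = x * z + y * z" "x * (y + z) = x * y + x * z"
    "(r *\<^sub>R x) * y = r *\<^sub>R (x * y)" "x * (r *\<^sub>R y) = r *\<^sub>R (x * y)"
  by (simp_all add: hquat_eq_iff hq_defs algebra_simps)

lemma hq_of_real_mult: "hq_of_real r * x = r *\<^sub>R x" "x * hq_of_real r = r *\<^sub>R x"
  by (simp_all add: hquat_eq_iff hq_defs)


section \<open>Hyperbolic \<open>k\<close>-Fibonacci quaternions\<close>

definition HF :: "real \<Rightarrow> int \<Rightarrow> hquat" where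
  "HF k n = hq_of_real (kfib k n) + hq_I * hq_of_real (kfib k (n + 1))
     + hq_J * hq_of_real (kfib k (n + 2)) + hq_K * hq_of_real (kfib k (n + 3))"

end

theory Submission
  imports Defs
begin

text \<open>
  The numbers \<open>F = kfib k\<close> satisfy the convolution identity
  \<open>F (a + 1) * F b + F a * F (b - 1) = F (a + b)\<close>. Summing it over the entries of the
  multiplication table, the off-diagonal units cancel because the two orders of a product of
  imaginary units have the same index sum and opposite signs.
  What remains is \<open>2 * F (n + m + l)\<close>, \<open>l = 1, 2, 3\<close>, in the three imaginary parts and
  \<open>F (n + m) + F (n + m + 2) + F (n + m + 4) + F (n + m + 6)\<close> in the real part.
\<close>

text \<open>By the recurrence, passing from \<open>(a, b)\<close> to \<open>(a + 1, b - 1)\<close>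
  preserves the left side, which is \<open>kfib k b\<close> at \<open>a = 0\<close>. Hence
  \<open>b\<close> stays arbitrary.\<close>

lemma kfib_add: "kfib k (a + 1) * kfib k b + kfib k a * kfib k (b - 1) = kfib k (a + b)"
proof (induction a arbitrary: b rule: int_induct [where k = 0])
  case base
  show ?case by simp
next
  case (step1 a)
  show ?case
    using step1.IH [of "b + 1"] kfib_rec [of k "a + 1"] kfib_rec [of k b]
    by (simp add: algebra_simps)
next
  case (step2 a)
  show ?case
    using step2.IH [of "b - 1"] kfib_rec [of k a] kfib_rec [of k "b - 1"]
    by (simp add: algebra_simps)
qed

lemma HF_eq_HQuat: "HF k n = HQuat (kfib k n) (kfib k (n + 1)) (kfib k (n + 2)) (kfib k (n + 3))"
  by (simp add: HF_def hq_defs)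

theorem theorem2p3:
  fixes k :: real and n m :: nat
  assumes "k > 0"
  shows "HF k (int n + 1) * HF k (int m) + HF k (int n) * HF k (int m - 1)
       = 2 *\<^sub>R HF k (int n + int m)
         + hq_of_real (k * kfib k (int n + int m + 1))
         + hq_of_real (kluc k (n + m + 5))"
proof -
  define s where "s = int n + int m"
  \<comment> \<open>\<open>p\<close> and \<open>q\<close> are the positions, 0 to 3, of the
    components multiplied: one instance per entry of the multiplication table.\<close>
  have conv: "kfib k (int n + 1 + p) * kfib k (int m + q)
      + kfib k (int n + p) * kfib k (int m - 1 + q) = kfib k (s + (p + q))" for p q
    using kfib_add [of k "int n + p" "int m + q"] by (simp add: s_def algebra_simps)
  note conv_0 = conv [of 0 0] conv [of 0 1] conv [of 0 2] conv [of 0 3]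
  note conv_1 = conv [of 1 0] conv [of 1 1] conv [of 1 2] conv [of 1 3]
  note conv_2 = conv [of 2 0] conv [of 2 1] conv [of 2 2] conv [of 2 3]
  note conv_3 = conv [of 3 0] conv [of 3 1] conv [of 3 2] conv [of 3 3]
  have luc: "kluc k (n + m + 5) = kfib k (s + 6) + kfib k (s + 4)"
    by (simp add: kluc_eq_kfib s_def add.commute)
  \<comment> \<open>Turns the summands \<open>kfib k s + kfib k (s + 2)\<close> of the real part
    into \<open>2 * kfib k s + k * kfib k (s + 1)\<close>; \<open>luc\<close> covers the other
    two.\<close>
  have rec: "kfib k (s + 2) = k * kfib k (s + 1) + kfib k s"
    using kfib_rec [of k "s + 1"] by (simp add: add.assoc)
  show ?thesis
    unfolding HF_eq_HQuat luc s_def [symmetric] hq_defs hquat_eq_iff hquat.sel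
    using conv_0 conv_1 conv_2 conv_3 rec
    by (simp add: algebra_simps)
qed

end
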